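(* Let $2\le n_1<n_2<\cdots<n_m$ be integers, $t_1,\dots,t_m$ positive integers, $\overline{t}_k=\sum_{i=1}^k t_i$, and $G=K_{n_1}^{t_1}\square\cdots\square K_{n_m}^{t_m}$. If $\overline{t}_k\ge 1+\frac{n_k(n_k^2-1)}{6}$ for some $k\in\{1,\dots,m\}$, then $G$ is not radio graceful.
   Context: $K_n$ is the complete graph on $n$ vertices; $\square$ is the Cartesian product of graphs ($(a,b)\sim(a',b')$ iff $a=a'$ and $b\sim b'$, or $b=b'$ and $a\sim a'$) and $H^s$ is the Cartesian product of $s$ copies of $H$. A radio labeling of a connected graph $H$ is $f:V(H)\to\mathbb{Z}^+$ with $|f(u)-f(v)|\ge\mathrm{diam}(H)+1-d(u,v)$ for all distinct $u,v$. $H$ is radio graceful if it has a radio labeling that is a bijection onto $\{1,\dots,|V(H)|\}$. *)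

theory Defs
  imports "Graph_Theory.Graph_Theory"
begin

text \<open>Undirected graphs are rendered, as in Graph_Theory, by symmetric loop-free pair digraphs.\<close>

definition complete_graph :: "nat \<Rightarrow> nat pair_pre_digraph" where
  "complete_graph n =
     \<lparr> pverts = {..<n}, parcs = {(u, v). u < n \<and> v < n \<and> u \<noteq> v} \<rparr>"

lemma complete_graph_complete_digraph: "K\<^bsub>n\<^esub> (with_proj (complete_graph n))"
proof -
  have "{(u, v). u < n \<and> v < n \<and> u \<noteq> v} \<subseteq> {..<n} \<times> {..<n}" by auto
  then have "finite {(u, v). u < n \<and> v < n \<and> u \<noteq> v}"
    by (rule finite_subset) simp
  then have "pair_graph (complete_graph n)"
    by unfold_locales (auto simp: complete_graph_def symmetric_def sym_def)
  then have "graph (with_proj (complete_graph n))"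
    by (rule pair_graph.pair_graphD_graph)
  then show ?thesis
    unfolding complete_digraph_def by (auto simp: complete_graph_def)
qed

definition cart_prod ::
    "'a pair_pre_digraph \<Rightarrow> 'b pair_pre_digraph \<Rightarrow> ('a \<times> 'b) pair_pre_digraph" (infixr "\<box>" 70)
  where
  "G \<box> H =
     \<lparr> pverts = pverts G \<times> pverts H,
       parcs = {((a, b), (a', b')).
          a = a' \<and> a \<in> pverts G \<and> (b, b') \<in> parcs H \<or>
          b = b' \<and> b \<in> pverts H \<and> (a, a') \<in> parcs G} \<rparr>"

definition relabel :: "('a \<Rightarrow> 'b) \<Rightarrow> 'a pair_pre_digraph \<Rightarrow> 'b pair_pre_digraph" where
  "relabel g G = \<lparr> pverts = g ` pverts G, parcs = map_prod g g ` parcs G \<rparr>"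

text \<open>
  The product of a variable number of factors needs one vertex type for all lengths, so the
  iterated binary product is transported along the injection \<open>(x, xs) \<mapsto> x # xs\<close>. The empty product
  is the one-vertex graph.
\<close>

primrec cart_prod_list :: "'a pair_pre_digraph list \<Rightarrow> 'a list pair_pre_digraph" where
  "cart_prod_list [] = \<lparr> pverts = {[]}, parcs = {} \<rparr>"
| "cart_prod_list (H # Hs) = relabel (\<lambda>(x, xs). x # xs) (H \<box> cart_prod_list Hs)"

lemma pair_graph_cart_prod:
  assumes "pair_graph G" "pair_graph H"
  shows "pair_graph (G \<box> H)"
proof -
  interpret G: pair_graph G by fact
  interpret H: pair_graph H by fact
  have fin: "finite (pverts (G \<box> H))"
    by (simp add: cart_prod_def G.pair_finite_verts H.pair_finite_verts)
  have sub: "parcs (G \<box> H) \<subseteq> pverts (G \<box> H) \<times> pverts (G \<box> H)"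
    by (auto simp: cart_prod_def dest: G.in_arcsD1 G.in_arcsD2 H.in_arcsD1 H.in_arcsD2)
  have "sym (parcs (G \<box> H))"
    by (auto simp: cart_prod_def sym_def dest: G.arcs_symmetric H.arcs_symmetric)
  moreover have "fst e \<noteq> snd e" if "e \<in> parcs (G \<box> H)" for e
    using that by (auto simp: cart_prod_def dest: G.no_loops' H.no_loops')
  ultimately show ?thesis
    using fin sub finite_subset[OF sub]
    by unfold_locales (auto simp: symmetric_def)
qed

lemma pair_graph_relabel:
  assumes "pair_graph G" "inj_on g (pverts G)"
  shows "pair_graph (relabel g G)"
proof -
  interpret G: pair_graph G by fact
  have "sym (parcs (relabel g G))"
    by (force simp: relabel_def sym_def dest: G.arcs_symmetric)
  moreover have "fst e \<noteq> snd e" if "e \<in> parcs (relabel g G)" for e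
    using that assms(2)
    by (auto simp: relabel_def inj_on_def) (metis G.no_loops' G.in_arcsD1 G.in_arcsD2)
  ultimately show ?thesis
    by unfold_locales
      (auto simp: relabel_def symmetric_def G.pair_finite_verts G.pair_finite_arcs
        dest: G.in_arcsD1 G.in_arcsD2)
qed

lemma pair_graph_cart_prod_list:
  assumes "\<forall>H\<in>set Hs. pair_graph H"
  shows "pair_graph (cart_prod_list Hs)"
  using assms
proof (induction Hs)
  case Nil
  show ?case by unfold_locales (auto simp: symmetric_def)
next
  case (Cons H Hs)
  then show ?case
    by (auto intro!: pair_graph_relabel pair_graph_cart_prod inj_onI)
qed

definition cart_power :: "'a pair_pre_digraph \<Rightarrow> nat \<Rightarrow> 'a list pair_pre_digraph" where
  "cart_power H s = cart_prod_list (replicate s H)"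

definition graph_dist :: "'a pair_pre_digraph \<Rightarrow> 'a \<Rightarrow> 'a \<Rightarrow> ereal" where
  "graph_dist G u v = wf_digraph.\<mu> (with_proj G) (\<lambda>_. 1) u v"

definition graph_diam :: "'a pair_pre_digraph \<Rightarrow> ereal" where
  "graph_diam G = (SUP u\<in>pverts G. SUP v\<in>pverts G. graph_dist G u v)"

text \<open>
  The next two notions are meant for finite connected graphs, where all distances and the diameter
  are finite. Connectedness is deliberately not a conjunct: a disconnected graph must not fail to be
  radio graceful merely by being disconnected.
\<close>

definition radio_labeling :: "'a pair_pre_digraph \<Rightarrow> ('a \<Rightarrow> nat) \<Rightarrow> bool" where
  "radio_labeling H f \<longleftrightarrow>
     (\<forall>u\<in>pverts H. f u > 0) \<and>
     (\<forall>u\<in>pverts H. \<forall>v\<in>pverts H. u \<noteq> v \<longrightarrow>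
        ereal \<bar>real (f u) - real (f v)\<bar> \<ge> graph_diam H + 1 - graph_dist H u v)"

definition radio_graceful :: "'a pair_pre_digraph \<Rightarrow> bool" where
  "radio_graceful H \<longleftrightarrow>
     (\<exists>f. radio_labeling H f \<and> bij_betw f (pverts H) {1..card (pverts H)})"

end

theory Submission
  imports Defs
begin

text \<open>
  Distance in \<open>G\<close> counts the coordinates in which two vertices differ, and the diameter is the total
  number of coordinates. A graceful radio labeling therefore lists the vertices in such a way that
  vertices at positions \<open>a < b\<close> agree in at most \<open>b - a - 1\<close> coordinates. Among \<open>n\<^sub>k + 1\<close> consecutive
  vertices, each of the coordinates of size at most \<open>n\<^sub>k\<close> is repeated by the pigeonhole principle, so
  the number of these coordinates is at most the sum of \<open>b - a - 1\<close> over all pairs, which is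
  \<open>n\<^sub>k (n\<^sub>k\<^sup>2 - 1) / 6\<close>.
\<close>

subsection \<open>Distances in Cartesian products\<close>

text \<open>A local description of the graph distance that, unlike infima over walks, passes easily to products.\<close>

definition path_metric :: "'a pair_pre_digraph \<Rightarrow> ('a \<Rightarrow> 'a \<Rightarrow> nat) \<Rightarrow> bool" where
  "path_metric G d \<longleftrightarrow>
     (\<forall>v\<in>pverts G. d v v = 0) \<and>
     (\<forall>u w v. (u, w) \<in> parcs G \<longrightarrow> v \<in> pverts G \<longrightarrow> d u v \<le> Suc (d w v)) \<and>
     (\<forall>u\<in>pverts G. \<forall>v\<in>pverts G. u \<noteq> v \<longrightarrow> (\<exists>w. (u, w) \<in> parcs G \<and> d u v = Suc (d w v)))"

text \<open>Each arc of a walk lowers \<open>d\<close> by at most one, which bounds walk lengths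
  from below. Conversely, repeatedly moving to a neighbour where \<open>d\<close> drops by one gives
  a walk of length \<open>d u v\<close>.\<close>

lemma path_metric_graph_dist:
  assumes "pair_graph G" "path_metric G d" "u \<in> pverts G" "v \<in> pverts G"
  shows "graph_dist G u v = ereal (real (d u v))"
proof -
  interpret pair_graph G by fact
  have lower: "d x v \<le> length p" if "awalk x p v" for x p
    using that
  proof (induction p arbitrary: x)
    case Nil
    then show ?case using assms(2) by (auto simp: awalk_Nil_iff path_metric_def)
  next
    case (Cons e p)
    then obtain w where "e = (x, w)" "(x, w) \<in> parcs G" "awalk w p v"
      by (cases e) (auto simp: awalk_Cons_iff)
    then have "d x v \<le> Suc (d w v)" "d w v \<le> length p"
      using Cons.IH assms(2,4) by (auto simp: path_metric_def)
    then show ?case by simp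
  qed
  have upper: "\<exists>p. awalk x p v \<and> length p = k" if "x \<in> pverts G" "d x v = k" for x k
    using that
  proof (induction k arbitrary: x)
    \<comment> \<open>If \<open>x\<close> differed from \<open>v\<close>, the descent condition
      would make \<open>d x v\<close> a successor.\<close>
    case 0
    then have "x = v"
      using assms(2,4) by (fastforce simp: path_metric_def)
    then show ?case using 0 by (auto simp: awalk_Nil_iff)
  next
    case (Suc k)
    then have "x \<noteq> v" using assms(2,4) by (auto simp: path_metric_def)
    then obtain w where w: "(x, w) \<in> parcs G" "d x v = Suc (d w v)"
      using Suc.prems assms(2,4) unfolding path_metric_def by blast
    then have "w \<in> pverts G" by (auto dest: in_arcsD2)
    then obtain p where "awalk w p v" "length p = k" using Suc w by auto
    then show ?case using w by (intro exI[of _ "(x, w) # p"]) (auto simp: awalk_Cons_iff)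
  qed
  have cost: "awalk_cost (\<lambda>_. 1) p = real (length p)" for p :: "('a \<times> 'a) list"
    by (induction p) auto
  obtain p where "awalk u p v" "length p = d u v" using upper assms(3) by blast
  then show ?thesis
    unfolding graph_dist_def \<mu>_def
    by (intro antisym INF_lower2[of p] INF_greatest) (auto simp: cost dest: lower)
qed

lemma path_metric_complete_graph:
  "path_metric (complete_graph n) (\<lambda>u v. of_bool (u \<noteq> v))"
  by (auto simp: path_metric_def complete_graph_def)

text \<open>An arc of the product changes one component, hence one summand. For the descent, move in
  the first component until it is correct, then in the second.\<close>

lemma path_metric_cart_prod:
  assumes "path_metric G d" "path_metric H e"
  shows "path_metric (G \<box> H) (\<lambda>(a, b) (a', b'). d a a' + e b b')"
  unfolding path_metric_def
proof (intro conjI allI impI ballI)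
  fix x assume "x \<in> pverts (G \<box> H)"
  then show "(case x of (a, b) \<Rightarrow> \<lambda>(a', b'). d a a' + e b b') x = 0"
    using assms by (auto simp: path_metric_def cart_prod_def)
next
  fix x z y assume "(x, z) \<in> parcs (G \<box> H)" "y \<in> pverts (G \<box> H)"
  then show "(case x of (a, b) \<Rightarrow> \<lambda>(a', b'). d a a' + e b b') y
      \<le> Suc ((case z of (a, b) \<Rightarrow> \<lambda>(a', b'). d a a' + e b b') y)"
    using assms by (auto simp: path_metric_def cart_prod_def)
next
  fix x y assume V: "x \<in> pverts (G \<box> H)" "y \<in> pverts (G \<box> H)" and "x \<noteq> y"
  obtain a b a' b' where xy: "x = (a, b)" "y = (a', b')" by fastforce
  show "\<exists>z. (x, z) \<in> parcs (G \<box> H) \<and> (case x of (a, b) \<Rightarrow> \<lambda>(a', b'). d a a' + e b b') y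
      = Suc ((case z of (a, b) \<Rightarrow> \<lambda>(a', b'). d a a' + e b b') y)"
  proof (cases "a = a'")
    case False
    then obtain c where "(a, c) \<in> parcs G" "d a a' = Suc (d c a')"
      using assms(1) V unfolding path_metric_def xy cart_prod_def by simp blast
    then show ?thesis
      using V by (intro exI[of _ "(c, b)"]) (auto simp: xy cart_prod_def)
  next
    case True
    then obtain c where "(b, c) \<in> parcs H" "e b b' = Suc (e c b')"
      using assms(2) V \<open>x \<noteq> y\<close> unfolding path_metric_def xy cart_prod_def by simp blast
    then show ?thesis
      using V by (intro exI[of _ "(a, c)"]) (auto simp: xy cart_prod_def)
  qed
qed

lemma path_metric_relabel:
  assumes "path_metric G (\<lambda>u v. d (g u) (g v))"
  shows "path_metric (relabel g G) d"
  unfolding path_metric_def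
proof (intro conjI allI impI ballI)
  fix x y assume V: "x \<in> pverts (relabel g G)" "y \<in> pverts (relabel g G)" and "x \<noteq> y"
  then obtain u v where uv: "x = g u" "y = g v" "u \<in> pverts G" "v \<in> pverts G" "u \<noteq> v"
    by (auto simp: relabel_def)
  then obtain w where "(u, w) \<in> parcs G" "d (g u) (g v) = Suc (d (g w) (g v))"
    using assms unfolding path_metric_def by blast
  then show "\<exists>z. (x, z) \<in> parcs (relabel g G) \<and> d x y = Suc (d z y)"
    by (intro exI[of _ "g w"]) (force simp: relabel_def uv)
qed (use assms in \<open>auto simp: path_metric_def relabel_def\<close>)

text \<open>For the 0-1 distance \<open>d\<close> this is the Hamming distance. Keeping
  \<open>d\<close> arbitrary allows nesting, as needed for a product of powers.\<close>

definition list_dist :: "('a \<Rightarrow> 'a \<Rightarrow> nat) \<Rightarrow> 'a list \<Rightarrow> 'a list \<Rightarrow> nat" where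
  "list_dist d xs ys = sum_list (map2 d xs ys)"

lemma path_metric_cart_prod_list:
  assumes "\<forall>H\<in>set Hs. path_metric H d"
  shows "path_metric (cart_prod_list Hs) (list_dist d)"
  using assms
proof (induction Hs)
  case Nil
  show ?case by (auto simp: path_metric_def list_dist_def)
next
  case (Cons H Hs)
  have "(\<lambda>x y. list_dist d (case x of (x, xs) \<Rightarrow> x # xs) (case y of (x, xs) \<Rightarrow> x # xs)) =
      (\<lambda>(a, b) (a', b'). d a a' + list_dist d b b')"
    by (auto simp: list_dist_def fun_eq_iff)
  then show ?case
    using Cons path_metric_cart_prod[of H d "cart_prod_list Hs" "list_dist d"]
    by (auto intro!: path_metric_relabel)
qed

lemma list_dist_eq_sum:
  assumes "length xs = n" "length ys = n"
  shows "list_dist d xs ys = (\<Sum>i<n. d (xs ! i) (ys ! i))"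
  using assms by (simp add: list_dist_def sum_list_sum_nth atLeast0LessThan)

lemma pverts_cart_prod_list:
  "xs \<in> pverts (cart_prod_list Hs) \<longleftrightarrow> list_all2 (\<lambda>x H. x \<in> pverts H) xs Hs"
  by (induction Hs arbitrary: xs)
    (auto simp: relabel_def cart_prod_def image_iff list_all2_Cons2)

subsection \<open>Products of complete graphs\<close>

text \<open>Factors are indexed from 0 so that an index is also a position in the vertex
  list.\<close>

definition hamming_graph :: "nat \<Rightarrow> (nat \<Rightarrow> nat) \<Rightarrow> (nat \<Rightarrow> nat) \<Rightarrow> nat list list pair_pre_digraph" where
  "hamming_graph m n t =
     cart_prod_list (map (\<lambda>i. cart_power (complete_graph (n i)) (t i)) [0..<m])"

text \<open>The pair \<open>(i, j)\<close> stands for copy \<open>j\<close> of factor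
  \<open>i\<close>; this flat index set turns distances into cardinalities.\<close>

definition coords :: "nat \<Rightarrow> (nat \<Rightarrow> nat) \<Rightarrow> (nat \<times> nat) set" where
  "coords m t = (SIGMA i:{..<m}. {..<t i})"

definition coord :: "nat list list \<Rightarrow> nat \<times> nat \<Rightarrow> nat" where
  "coord u p = u ! fst p ! snd p"

definition of_coords :: "nat \<Rightarrow> (nat \<Rightarrow> nat) \<Rightarrow> (nat \<times> nat \<Rightarrow> nat) \<Rightarrow> nat list list" where
  "of_coords m t g = map (\<lambda>i. map (\<lambda>j. g (i, j)) [0..<t i]) [0..<m]"

lemma finite_coords: "finite (coords m t)"
  by (simp add: coords_def)

lemma card_coords: "card (coords m t) = (\<Sum>i<m. t i)"
  by (simp add: coords_def)

lemma coord_of_coords: "p \<in> coords m t \<Longrightarrow> coord (of_coords m t g) p = g p"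
  by (auto simp: coord_def of_coords_def coords_def)

lemma pair_graph_complete_graph: "pair_graph (complete_graph n)"
proof -
  have "finite {(u, v). u < n \<and> v < n \<and> u \<noteq> v}"
    by (rule finite_subset[of _ "{..<n} \<times> {..<n}"]) auto
  then show ?thesis
    by unfold_locales (auto simp: complete_graph_def symmetric_def sym_def)
qed

lemma pair_graph_hamming_graph: "pair_graph (hamming_graph m n t)"
  unfolding hamming_graph_def cart_power_def
  by (auto intro!: pair_graph_cart_prod_list pair_graph_complete_graph)

lemma pverts_power_complete_graph:
  "xs \<in> pverts (cart_power (complete_graph n) s) \<longleftrightarrow> length xs = s \<and> (\<forall>j<s. xs ! j < n)"
  by (auto simp: cart_power_def pverts_cart_prod_list list_all2_conv_all_nth complete_graph_def)

lemma pverts_hamming_graph: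
  "u \<in> pverts (hamming_graph m n t) \<longleftrightarrow>
     length u = m \<and> (\<forall>i<m. length (u ! i) = t i) \<and> (\<forall>p\<in>coords m t. coord u p < n (fst p))"
  by (auto simp: hamming_graph_def pverts_cart_prod_list list_all2_conv_all_nth
      pverts_power_complete_graph coords_def coord_def)

lemma of_coords_in_hamming_graph:
  assumes "\<And>p. p \<in> coords m t \<Longrightarrow> g p < n (fst p)"
  shows "of_coords m t g \<in> pverts (hamming_graph m n t)"
  using assms by (auto simp: pverts_hamming_graph coord_of_coords) (auto simp: of_coords_def)

lemma graph_dist_hamming_graph:
  assumes "u \<in> pverts (hamming_graph m n t)" "v \<in> pverts (hamming_graph m n t)"
  shows "graph_dist (hamming_graph m n t) u v =
    ereal (real (card {p \<in> coords m t. coord u p \<noteq> coord v p}))"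
proof -
  let ?d = "list_dist (list_dist (\<lambda>x y :: nat. of_bool (x \<noteq> y)))"
  have "path_metric (hamming_graph m n t) ?d"
    unfolding hamming_graph_def cart_power_def
    by (auto intro!: path_metric_cart_prod_list path_metric_complete_graph)
  then have "graph_dist (hamming_graph m n t) u v = ereal (real (?d u v))"
    using assms by (intro path_metric_graph_dist pair_graph_hamming_graph)
  also have "?d u v = (\<Sum>i<m. \<Sum>j<t i. of_bool (u ! i ! j \<noteq> v ! i ! j))"
    using assms by (auto simp: pverts_hamming_graph list_dist_eq_sum intro!: sum.cong)
  also have "\<dots> = (\<Sum>p\<in>coords m t. of_bool (coord u p \<noteq> coord v p))"
    \<comment> \<open>The nested sums have to be merged before \<open>sum_of_bool_eq\<close> turns
      them into cardinalities.\<close>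
    by (simp add: coords_def sum.Sigma coord_def case_prod_unfold
        del: sum_of_bool_eq)
  also have "\<dots> = card {p \<in> coords m t. coord u p \<noteq> coord v p}"
    using finite_coords by (simp add: Int_def)
  finally show ?thesis .
qed

text \<open>The all-0 and all-1 vertices differ in every coordinate. A lower bound suffices, since a
  larger diameter only strengthens the radio condition.\<close>

lemma graph_diam_hamming_graph_ge:
  assumes "\<And>i. i < m \<Longrightarrow> 2 \<le> n i"
  shows "ereal (real (card (coords m t))) \<le> graph_diam (hamming_graph m n t)"
proof -
  let ?u = "of_coords m t (\<lambda>_. 0)" and ?v = "of_coords m t (\<lambda>_. 1)"
  have n: "1 < n (fst p)" if "p \<in> coords m t" for p
    using that assms[of "fst p"] by (auto simp: coords_def)
  have uv: "?u \<in> pverts (hamming_graph m n t)" "?v \<in> pverts (hamming_graph m n t)"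
    using n by (auto intro!: of_coords_in_hamming_graph intro: less_trans[of 0 1])
  have "{p \<in> coords m t. coord ?u p \<noteq> coord ?v p} = coords m t"
    by (auto simp: coord_of_coords)
  then have "ereal (real (card (coords m t))) = graph_dist (hamming_graph m n t) ?u ?v"
    using graph_dist_hamming_graph[OF uv] by simp
  also have "\<dots> \<le> graph_diam (hamming_graph m n t)"
    unfolding graph_diam_def using uv by (intro SUP_upper2[OF uv(1)] SUP_upper)
  finally show ?thesis .
qed

text \<open>Ensures that \<open>n k + 1\<close> consecutive labels exist. One coordinate of size
  \<open>n k\<close> supplies \<open>n k\<close> vertices, and a second coordinate supplies one
  more.\<close>

lemma card_pverts_hamming_graph_gt:
  assumes "\<And>i. i < m \<Longrightarrow> 2 \<le> n i" "k < m" "0 < t k" "2 \<le> (\<Sum>i<m. t i)"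
  shows "n k < card (pverts (hamming_graph m n t))"
proof -
  define p where "p = (k, 0 :: nat)"
  have p: "p \<in> coords m t" using assms by (auto simp: p_def coords_def)
  have "\<not> coords m t \<subseteq> {p}"
    using card_mono[of "{p}" "coords m t"] assms(4) by (auto simp: card_coords)
  then obtain q where q: "q \<in> coords m t" "q \<noteq> p" by auto
  \<comment> \<open>For \<open>a < n k\<close> the value \<open>a\<close> is placed at
    \<open>p\<close>; the remaining index \<open>a = n k\<close> gives the extra vertex, the only
    one that is nonzero at \<open>q\<close>.\<close>
  define h where "h a = of_coords m t
      (\<lambda>r. if a < n k then if r = p then a else 0 else if r = q then 1 else 0)" for a
  have "inj_on h {..n k}"
  proof (rule inj_onI)
    fix a b assume "a \<in> {..n k}" "b \<in> {..n k}" "h a = h b"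
    then have "coord (h a) p = coord (h b) p" "coord (h a) q = coord (h b) q" by simp_all
    then show "a = b"
      using p q \<open>a \<in> {..n k}\<close> \<open>b \<in> {..n k}\<close>
      by (auto simp: h_def coord_of_coords split: if_splits)
  qed
  then have "card (h ` {..n k}) = Suc (n k)" by (simp add: card_image)
  moreover have "h a \<in> pverts (hamming_graph m n t)" for a
    unfolding h_def
  proof (rule of_coords_in_hamming_graph)
    fix r assume "r \<in> coords m t"
    then have "2 \<le> n (fst r)" using assms(1)[of "fst r"] by (auto simp: coords_def)
    then show "(if a < n k then if r = p then a else 0 else if r = q then 1 else 0) < n (fst r)"
      by (auto simp: p_def)
  qed
  then have "h ` {..n k} \<subseteq> pverts (hamming_graph m n t)" by auto
  moreover have "finite (pverts (hamming_graph m n t))"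
  proof -
    interpret pair_graph "hamming_graph m n t" by (rule pair_graph_hamming_graph)
    show ?thesis by (rule pair_finite_verts)
  qed
  ultimately show ?thesis by (metis Suc_le_eq card_mono)
qed

subsection \<open>Counting repetitions\<close>

text \<open>The inner sum is \<open>b\<close> choose 2, and these add up to \<open>n + 1\<close>
  choose 3. The factor 6 avoids division.\<close>

lemma sum_gaps: "6 * (\<Sum>b\<le>n. \<Sum>a<b. b - a - 1) = (n - 1) * n * (n + 1)" for n :: nat
proof -
  \<comment> \<open>Reverse the order of summation by \<open>c = b - a - 1\<close>.\<close>
  have "(\<Sum>a<b. b - a - 1) = (\<Sum>c<b. c)" for b :: nat
    using sum.nat_diff_reindex[of "\<lambda>c. c" b] by (simp add: diff_diff_add)
  moreover have "2 * (\<Sum>c<b. c) = b * (b - 1)" for b :: nat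
  proof (induction b)
    case (Suc b)
    then show ?case by (cases b) auto
  qed simp
  ultimately have gap: "2 * (\<Sum>a<b. b - a - 1) = b * (b - 1)" for b :: nat
    by simp
  show ?thesis
  proof (induction n)
    case (Suc n)
    have "6 * (\<Sum>a<Suc n. Suc n - a - 1) = 3 * (Suc n * n)" using gap[of "Suc n"] by simp
    with Suc show ?case by (cases n) (auto simp: algebra_simps)
  qed simp
qed

text \<open>Read \<open>c a p\<close> as coordinate \<open>p\<close> of the vertex at position
  \<open>a\<close>. The \<open>n + 1\<close> positions share \<open>n\<close> values, so each
  \<open>p\<close> lies in the agreement set of some pair \<open>a < b\<close>; the union bound then
  sums the gaps.\<close>

lemma card_coordinates_le:
  assumes "finite J" "\<And>a p. a \<le> n \<Longrightarrow> p \<in> J \<Longrightarrow> c a p < n"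
    and "\<And>a b. a < b \<Longrightarrow> b \<le> n \<Longrightarrow> card {p \<in> J. c a p = c b p} \<le> b - a - 1"
  shows "6 * card J \<le> (n - 1) * n * (n + 1)"
proof -
  have "J \<subseteq> (\<Union>b\<in>{..n}. \<Union>a\<in>{..<b}. {p \<in> J. c a p = c b p})"
  proof
    fix p assume "p \<in> J"
    then have "(\<lambda>a. c a p) ` {..n} \<subseteq> {..<n}" using assms(2) by auto
    then have "card ((\<lambda>a. c a p) ` {..n}) < card {..n}"
      using card_mono[of "{..<n}"] by (simp add: less_Suc_eq_le)
    then have "\<not> inj_on (\<lambda>a. c a p) {..n}" by (rule pigeonhole)
    then obtain a b where "a \<le> n" "b \<le> n" "a < b" "c a p = c b p"
      by (auto simp: inj_on_def) (metis linorder_neqE_nat)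
    then show "p \<in> (\<Union>b\<in>{..n}. \<Union>a\<in>{..<b}. {p \<in> J. c a p = c b p})" using \<open>p \<in> J\<close> by auto
  qed
  then have "card J \<le> card (\<Union>b\<in>{..n}. \<Union>a\<in>{..<b}. {p \<in> J. c a p = c b p})"
    using assms(1) by (intro card_mono) auto
  also have "\<dots> \<le> (\<Sum>b\<le>n. card (\<Union>a\<in>{..<b}. {p \<in> J. c a p = c b p}))"
    by (rule card_UN_le) simp
  also have "\<dots> \<le> (\<Sum>b\<le>n. \<Sum>a<b. card {p \<in> J. c a p = c b p})"
    by (intro sum_mono card_UN_le) simp
  also have "\<dots> \<le> (\<Sum>b\<le>n. \<Sum>a<b. b - a - 1)"
    using assms(3) by (intro sum_mono) auto
  finally show ?thesis using sum_gaps[of n] by linarith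
qed

section \<open>Radio labelings of products of complete graphs\<close>

text \<open>The distance is the number of coordinates minus the number of agreements, so the radio
  condition leaves at least one more than the agreements as label difference.\<close>

lemma radio_labeling_hamming_graph_agreements:
  assumes "\<And>i. i < m \<Longrightarrow> 2 \<le> n i" "radio_labeling (hamming_graph m n t) f"
    and "u \<in> pverts (hamming_graph m n t)" "v \<in> pverts (hamming_graph m n t)" "f u < f v"
  shows "card {p \<in> coords m t. coord u p = coord v p} \<le> f v - f u - 1"
proof -
  let ?G = "hamming_graph m n t" and ?E = "{p \<in> coords m t. coord u p = coord v p}"
    and ?D = "{p \<in> coords m t. coord u p \<noteq> coord v p}"
  have "graph_diam ?G + 1 - graph_dist ?G u v \<le> ereal \<bar>real (f u) - real (f v)\<bar>"
    using assms(2-4) less_imp_neq[OF assms(5)] unfolding radio_labeling_def by metis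
  moreover have "ereal (real (card (coords m t))) + 1 - graph_dist ?G u v
      \<le> graph_diam ?G + 1 - graph_dist ?G u v"
    using graph_diam_hamming_graph_ge[OF assms(1)] by (intro ereal_minus_mono add_right_mono) auto
  ultimately have "ereal (real (card (coords m t))) + 1 - ereal (real (card ?D))
      \<le> ereal \<bar>real (f u) - real (f v)\<bar>"
    unfolding graph_dist_hamming_graph[OF assms(3,4)] by (rule order_trans[rotated])
  then have "card (coords m t) + 1 \<le> (f v - f u) + card ?D"
    using assms(5) by (simp add: one_ereal_def)
  moreover have "card (coords m t) = card ?E + card ?D"
    using finite_coords[of m t] by (subst card_Un_disjoint[symmetric]) (auto intro: arg_cong[of _ _ card])
  ultimately show ?thesis by simp
qed

text \<open>The counting bound is applied to the vertices labelled 1 to \<open>n k + 1\<close> and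
  to the coordinates of factors 0 to \<open>k\<close>, whose values stay below \<open>n k\<close> by
  \<open>le\<close>.\<close>

lemma hamming_graph_not_radio_graceful:
  assumes n: "\<And>i. i < m \<Longrightarrow> 2 \<le> n i" and k: "k < m" "0 < t k"
    and le: "\<And>i. i \<le> k \<Longrightarrow> n i \<le> n k"
    and large: "(n k - 1) * n k * (n k + 1) < 6 * (\<Sum>i\<le>k. t i)"
  shows "\<not> radio_graceful (hamming_graph m n t)"
proof
  let ?G = "hamming_graph m n t"
  assume "radio_graceful ?G"
  then obtain f where f: "radio_labeling ?G f" "bij_betw f (pverts ?G) {1..card (pverts ?G)}"
    by (auto simp: radio_graceful_def)
  define J where "J = coords (Suc k) t"
  have J: "J \<subseteq> coords m t" using k by (auto simp: J_def coords_def)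
  have "2 \<le> (\<Sum>i\<le>k. t i)"
  proof -
    \<comment> \<open>As \<open>n k\<close> is at least 2, the product is at least 6, so
      \<open>large\<close> forces more than one coordinate.\<close>
    have "1 * 2 * 3 \<le> (n k - 1) * n k * (n k + 1)"
      using n[OF k(1)] by (intro mult_le_mono) auto
    then show ?thesis using large by linarith
  qed
  also have "\<dots> \<le> (\<Sum>i<m. t i)" using k by (intro sum_mono2) auto
  finally have card_gt: "n k < card (pverts ?G)"
    using n k by (intro card_pverts_hamming_graph_gt)
  \<comment> \<open>Labels start at 1 and positions at 0, hence \<open>Suc a\<close>; the shift
    cancels in the gaps.\<close>
  define x where "x a = inv_into (pverts ?G) f (Suc a)" for a
  have x: "x a \<in> pverts ?G" "f (x a) = Suc a" if "a \<le> n k" for a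
    using that card_gt f(2) unfolding x_def
    by (auto simp: bij_betw_def intro!: inv_into_into f_inv_into_f)
  have "6 * card J \<le> (n k - 1) * n k * (n k + 1)"
  proof (rule card_coordinates_le)
    show "finite J" by (simp add: J_def finite_coords)
  next
    fix a p assume "a \<le> n k" "p \<in> J"
    then have "coord (x a) p < n (fst p)" using x(1) J by (auto simp: pverts_hamming_graph)
    also have "\<dots> \<le> n k" using \<open>p \<in> J\<close> le by (auto simp: J_def coords_def)
    finally show "coord (x a) p < n k" .
  next
    fix a b assume ab: "a < b" "b \<le> n k"
    have "card {p \<in> J. coord (x a) p = coord (x b) p}
        \<le> card {p \<in> coords m t. coord (x a) p = coord (x b) p}"
      using J by (intro card_mono) (auto simp: finite_coords)
    also have "\<dots> \<le> f (x b) - f (x a) - 1"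
      using ab x f(1) n by (intro radio_labeling_hamming_graph_agreements) auto
    finally show "card {p \<in> J. coord (x a) p = coord (x b) p} \<le> b - a - 1"
      using ab x by simp
  qed
  then show False using large by (simp add: J_def card_coords lessThan_Suc_atMost)
qed

theorem theorem16:
  fixes m :: nat and n t :: "nat \<Rightarrow> nat"
  assumes "2 \<le> n 1"
    and "strict_mono_on {1..m} n"
    and "\<forall>i\<in>{1..m}. t i > 0"
    and "\<exists>k\<in>{1..m}. real (\<Sum>i=1..k. t i) \<ge> 1 + real (n k) * ((real (n k))\<^sup>2 - 1) / 6"
  shows "\<not> radio_graceful
           (cart_prod_list (map (\<lambda>i. cart_power (complete_graph (n i)) (t i)) [1..<Suc m]))"
proof -
  have mono: "n i \<le> n j" if "1 \<le> i" "i \<le> j" "j \<le> m" for i j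
    using that strict_mono_onD[OF assms(2), of i j] by (cases "i = j") auto
  \<comment> \<open>The index given by the assumption is written as \<open>Suc k\<close> to pass to
    0-based factors.\<close>
  obtain k where k: "k < m"
    and large: "1 + real (n (Suc k)) * ((real (n (Suc k)))\<^sup>2 - 1) / 6 \<le> real (\<Sum>i=1..Suc k. t i)"
    using assms(4) by (metis Suc_le_eq Suc_pred' atLeastAtMost_iff less_eq_Suc_le One_nat_def)
  have n: "2 \<le> n (Suc i)" if "i < m" for i
    using assms(1) mono[of 1 "Suc i"] that by simp
  \<comment> \<open>The natural subtraction is exact here because \<open>n (Suc k)\<close> is
    positive.\<close>
  have "real ((n (Suc k) - 1) * n (Suc k) * (n (Suc k) + 1)) =
      real (n (Suc k)) * ((real (n (Suc k)))\<^sup>2 - 1)"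
    using n[OF k] by (simp add: of_nat_diff power2_eq_square algebra_simps)
  \<comment> \<open>The summand 1 in the assumed bound makes the inequality strict.\<close>
  also have "\<dots> < real (6 * (\<Sum>i\<le>k. t (Suc i)))"
  proof -
    have "(\<Sum>i=1..Suc k. t i) = (\<Sum>i\<le>k. t (Suc i))"
      unfolding atMost_atLeast0 One_nat_def by (rule sum.shift_bounds_cl_Suc_ivl)
    then show ?thesis using large by simp
  qed
  finally have "(n (Suc k) - 1) * n (Suc k) * (n (Suc k) + 1) < 6 * (\<Sum>i\<le>k. t (Suc i))"
    by (simp only: of_nat_less_iff)
  then have "\<not> radio_graceful (hamming_graph m (\<lambda>i. n (Suc i)) (\<lambda>i. t (Suc i)))"
    using n k mono assms(3) by (intro hamming_graph_not_radio_graceful[where k = k]) auto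
  also have "hamming_graph m (\<lambda>i. n (Suc i)) (\<lambda>i. t (Suc i)) =
      cart_prod_list (map (\<lambda>i. cart_power (complete_graph (n i)) (t i)) [1..<Suc m])"
    by (simp only: hamming_graph_def One_nat_def map_Suc_upt[symmetric] map_map comp_def)
  finally show ?thesis .
qed

end
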